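(* Let $\tau\ge 1$ be an integer, $c\in\mathbb{C}\setminus\{0\}$, let $a_0,a_1,\dots,a_\tau$ be complex constants with $a_\tau\neq0$, and let $L_c(z,f)=\sum_{j=0}^{\tau}a_jf(z+jc)$. If $f$ is a finite order transcendental entire solution of the equation $$f^2(z)+L_c(z,f)^2=1,$$ then $f$ is of the form $$f(z)=\frac{e^{az+b}+e^{-(az+b)}}{2}$$ with $a,b\in\mathbb{C}$ satisfying the two equations $$a_0+a_1e^{ac}+a_2e^{2ac}+\cdots+a_\tau e^{\tau ac}=-i,$$ $$a_0+a_1e^{-ac}+a_2e^{-2ac}+\cdots+a_\tau e^{-\tau ac}=i.$$ Here $e^{ac}\neq\pm1$. Moreover, if $\tau=1$, then necessarily $a_0\neq\pm a_1$.
   Context: The order of a meromorphic function $f$ on $\mathbb{C}$ is $\rho(f)=\limsup_{r\to\infty}\frac{\log T(r,f)}{\log r}$, where $T(r,f)$ is the Nevanlinna characteristic; finite order means $\rho(f)<\infty$. *)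

theory Defs
  imports "HOL-Complex_Analysis.Complex_Analysis"
begin

definition log_plus :: "real \<Rightarrow> real" where
  "log_plus x = (if x \<le> 1 then 0 else ln x)"

text \<open>For \<open>f\<close> meromorphic on the plane: the number of poles in the closed disc of radius \<open>t\<close>,
  counted with multiplicity (at a pole, \<^const>\<open>zorder\<close> is minus the pole order).\<close>

definition pole_count :: "real \<Rightarrow> (complex \<Rightarrow> complex) \<Rightarrow> nat" where
  "pole_count t f = (\<Sum>z | is_pole f z \<and> norm z \<le> t. nat (- zorder f z))"

definition proximity_fun :: "real \<Rightarrow> (complex \<Rightarrow> complex) \<Rightarrow> real" where
  "proximity_fun r f =
     1 / (2 * pi) * integral {0..2*pi} (\<lambda>\<theta>. log_plus (norm (f (of_real r * exp (\<i> * of_real \<theta>)))))"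

definition counting_fun :: "real \<Rightarrow> (complex \<Rightarrow> complex) \<Rightarrow> real" where
  "counting_fun r f =
     integral {0..r} (\<lambda>t. (real (pole_count t f) - real (pole_count 0 f)) / t)
       + real (pole_count 0 f) * ln r"

definition nevanlinna_T :: "real \<Rightarrow> (complex \<Rightarrow> complex) \<Rightarrow> real" where
  "nevanlinna_T r f = proximity_fun r f + counting_fun r f"

text \<open>The limit superior is taken in the extended reals, so infinite order is a genuine value.
  Where the characteristic vanishes (e.g. \<open>f = 0\<close>), the convention \<open>ln 0 = 0\<close> makes the
  quotient 0; the characteristic of a nonconstant meromorphic function is eventually positive.\<close>

definition growth_order :: "(complex \<Rightarrow> complex) \<Rightarrow> ereal" where
  "growth_order f = Limsup at_top (\<lambda>r::real. ereal (ln (nevanlinna_T r f) / ln r))"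

definition finite_order :: "(complex \<Rightarrow> complex) \<Rightarrow> bool" where
  "finite_order f \<longleftrightarrow> growth_order f < \<infinity>"

definition transcendental_entire :: "(complex \<Rightarrow> complex) \<Rightarrow> bool" where
  "transcendental_entire f \<longleftrightarrow> f holomorphic_on UNIV \<and> \<not> (\<exists>p. \<forall>z. f z = poly p z)"

definition shift_op ::
  "nat \<Rightarrow> (nat \<Rightarrow> complex) \<Rightarrow> complex \<Rightarrow> complex \<Rightarrow> (complex \<Rightarrow> complex) \<Rightarrow> complex" where
  "shift_op \<tau> a c z f = (\<Sum>j=0..\<tau>. a j * f (z + of_nat j * c))"

end

theory Submission
  imports Defs
begin

text \<open>
  Put \<open>L z = shift_op \<tau> a c z f\<close>. The factorisation \<open>(f + \<i> L) (f - \<i> L) = 1\<close> shows that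
  \<open>f + \<i> L\<close> has no zeros, so it equals \<open>exp g\<close> for an entire function \<open>g\<close>
  (\<open>entire_sum_squares_eq_1\<close>); then \<open>f = cosh g\<close> and \<open>L = - \<i> sinh g\<close>.

  Finite order makes \<open>g\<close> a polynomial (\<open>cosh_finite_order_imp_polynomial\<close>). Indeed
  \<open>\<bar>Re w\<bar>\<close> exceeds the positive part of \<open>ln \<bar>cosh w\<bar>\<close> by at most \<open>ln 3\<close>, so the mean of
  \<open>\<bar>Re g\<bar>\<close> over the circle of radius \<open>r\<close> is at most \<open>T(r, f) + ln 3\<close>, which grows at most like
  a power of \<open>r\<close>. The Taylor coefficients of \<open>g\<close> are Fourier coefficients of \<open>Re g\<close> on
  circles (\<open>norm_higher_deriv_le_integral_Re\<close>), so all but finitely many of them vanish.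

  The equation is now a linear relation between the exponentials of the polynomials
  \<open>\<plusminus> g(z + j c)\<close>. If \<open>g\<close> has degree at least 2, no two of these differ by a constant
  (\<open>degree_signed_shift_diff\<close>), so the exponentials are linearly independent
  (\<open>exp_poly_linear_independent\<close>, a special case of Borel's theorem) and \<open>a \<tau> = 0\<close>, a
  contradiction. Hence \<open>g z = \<alpha> z + \<beta>\<close> with \<open>\<alpha> \<noteq> 0\<close>, and comparing the coefficients of
  \<open>exp (g z)\<close> and \<open>exp (- g z)\<close> gives the two conditions on \<open>\<alpha>\<close>. The remaining claims
  follow from these conditions by algebra.
\<close>

section \<open>Linear independence of exponentials of polynomials\<close>

lemma degree_zero_if_periodic:
  fixes q :: "complex poly"
  assumes "h \<noteq> 0" and per: "\<And>z. poly q (z + h) = poly q z"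
  shows "degree q = 0"
proof -
  have "poly q (of_nat n * h) = poly q 0" for n
  proof (induction n)
    case (Suc n)
    have "poly q (of_nat (Suc n) * h) = poly q (of_nat n * h + h)"
      by (simp add: algebra_simps)
    then show ?case using per Suc by simp
  qed simp
  then have sub: "range (\<lambda>n. of_nat n * h) \<subseteq> {z. poly (q - [:poly q 0:]) z = 0}"
    by auto
  have "inj (\<lambda>n::nat. of_nat n * h)"
    using \<open>h \<noteq> 0\<close> by (auto intro: injI)
  then have "infinite (range (\<lambda>n::nat. of_nat n * h))"
    using range_inj_infinite by blast
  then have "q - [:poly q 0:] = 0"
    using sub poly_roots_finite finite_subset by metis
  then have "q = [:poly q 0:]" by simp
  then show ?thesis by (metis degree_pCons_0)
qed

lemma pderiv_add_mult_eq_0_iff: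
  fixes Q R :: "complex poly"
  assumes "R \<noteq> 0"
  shows "pderiv Q + R * Q = 0 \<longleftrightarrow> Q = 0"
proof
  assume eq: "pderiv Q + R * Q = 0"
  show "Q = 0"
  proof (rule ccontr)
    assume "Q \<noteq> 0"
    have RQ: "R * Q = - pderiv Q" using eq by (simp add: eq_neg_iff_add_eq_0 add.commute)
    then have "degree R + degree Q = degree Q - 1"
      using degree_mult_eq[OF assms \<open>Q \<noteq> 0\<close>] by (simp add: degree_pderiv)
    then have "degree Q = 0" by linarith
    then have "pderiv Q = 0" by (simp add: pderiv_eq_0_iff)
    then show False using RQ assms \<open>Q \<noteq> 0\<close> by simp
  qed
qed simp

lemma funpow_pderiv_add_mult_eq_0_iff:
  fixes Q R :: "complex poly"
  assumes "R \<noteq> 0"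
  shows "((\<lambda>q. pderiv q + R * q) ^^ n) Q = 0 \<longleftrightarrow> Q = 0"
  by (induction n) (simp_all add: pderiv_add_mult_eq_0_iff[OF assms])

lemma funpow_pderiv_eq_0:
  fixes Q :: "complex poly"
  shows "degree Q < n \<Longrightarrow> (pderiv ^^ n) Q = 0"
proof (induction n arbitrary: Q)
  case (Suc n)
  show ?case
  proof (cases "degree Q = 0")
    case True
    then have "pderiv Q = 0" by (simp add: pderiv_eq_0_iff)
    moreover have "(pderiv ^^ n) (0 :: complex poly) = 0" by (induction n) auto
    ultimately show ?thesis by (simp add: funpow_swap1)
  next
    case False
    then have "degree (pderiv Q) < n" using Suc.prems by (simp add: degree_pderiv)
    then show ?thesis using Suc.IH by (simp add: funpow_swap1)
  qed
qed simp

text \<open>Differentiating \<open>Q * exp R\<close> replaces the coefficient \<open>Q\<close> by \<open>pderiv Q + pderiv R * Q\<close>.\<close>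

lemma exp_poly_sum_deriv:
  fixes Q R :: "'i \<Rightarrow> complex poly" and q :: "complex poly"
  assumes "finite F" and zero: "\<And>z. poly q z + (\<Sum>i\<in>F. poly (Q i) z * exp (poly (R i) z)) = 0"
  shows "poly (pderiv q) z
         + (\<Sum>i\<in>F. poly (pderiv (Q i) + pderiv (R i) * Q i) z * exp (poly (R i) z)) = 0"
proof -
  have "((\<lambda>z. poly q z + (\<Sum>i\<in>F. poly (Q i) z * exp (poly (R i) z))) has_field_derivative
      (poly (pderiv q) z + (\<Sum>i\<in>F. poly (pderiv (Q i)) z * exp (poly (R i) z)
         + exp (poly (R i) z) * poly (pderiv (R i)) z * poly (Q i) z))) (at z)"
    by (intro derivative_eq_intros DERIV_sum refl | simp)+
  moreover have "((\<lambda>z. poly q z + (\<Sum>i\<in>F. poly (Q i) z * exp (poly (R i) z)))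
      has_field_derivative 0) (at z)"
    using zero by simp
  ultimately have "poly (pderiv q) z + (\<Sum>i\<in>F. poly (pderiv (Q i)) z * exp (poly (R i) z)
         + exp (poly (R i) z) * poly (pderiv (R i)) z * poly (Q i) z) = 0"
    using DERIV_unique by blast
  then show ?thesis by (simp add: algebra_simps)
qed

text \<open>Exponentials of polynomials no two of which differ by a constant are linearly independent
  over the polynomials. The proof is by induction on the number of terms: after division by one
  of the exponentials, its coefficient is killed by repeated differentiation, while the map
  \<open>Q \<mapsto> pderiv Q + pderiv R * Q\<close> that this induces on the other coefficients is injective.\<close>

theorem exp_poly_linear_independent:
  fixes Q P :: "'i \<Rightarrow> complex poly"
  assumes "finite F"
    and "\<And>i j. i \<in> F \<Longrightarrow> j \<in> F \<Longrightarrow> i \<noteq> j \<Longrightarrow> degree (P i - P j) \<noteq> 0"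
    and "\<And>z. (\<Sum>i\<in>F. poly (Q i) z * exp (poly (P i) z)) = 0"
    and "i \<in> F"
  shows "Q i = 0"
  using assms
proof (induction F arbitrary: P Q i rule: finite_induct)
  case (insert x F)
  define R where "R i = P i - P x" for i
  define D where "D i n = ((\<lambda>q. pderiv q + pderiv (R i) * q) ^^ n) (Q i)" for i n
  have divided: "poly (Q x) z + (\<Sum>i\<in>F. poly (Q i) z * exp (poly (R i) z)) = 0" for z
  proof -
    have "poly (Q x) z + (\<Sum>i\<in>F. poly (Q i) z * exp (poly (R i) z))
        = exp (- poly (P x) z) * (\<Sum>i\<in>insert x F. poly (Q i) z * exp (poly (P i) z))"
      using insert.hyps
      by (simp add: R_def ring_distribs sum_distrib_left exp_diff exp_minus field_simps)
    then show ?thesis using insert.prems(2) by simp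
  qed
  have iterated: "poly ((pderiv ^^ n) (Q x)) z + (\<Sum>i\<in>F. poly (D i n) z * exp (poly (R i) z)) = 0"
    for n z
  proof (induction n arbitrary: z)
    case 0
    then show ?case using divided by (simp add: D_def)
  next
    case (Suc n)
    from exp_poly_sum_deriv[OF insert.hyps(1) Suc, of z] show ?case by (simp add: D_def)
  qed
  have rest: "Q j = 0" if "j \<in> F" for j
  proof -
    have "(\<Sum>i\<in>F. poly (D i (Suc (degree (Q x)))) z * exp (poly (R i) z)) = 0" for z
      using iterated[of "Suc (degree (Q x))" z] funpow_pderiv_eq_0[of "Q x" "Suc (degree (Q x))"]
      by simp
    moreover have "degree (R i - R j) \<noteq> 0" if "i \<in> F" "j \<in> F" "i \<noteq> j" for i j
      using insert.prems(1)[of i j] that by (simp add: R_def)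
    ultimately have "D j (Suc (degree (Q x))) = 0"
      using insert.IH[of R "\<lambda>i. D i (Suc (degree (Q x)))" j] that by blast
    moreover have "pderiv (R j) \<noteq> 0"
      using insert.prems(1)[of j x] that insert.hyps by (auto simp: pderiv_eq_0_iff R_def)
    ultimately show ?thesis
      by (simp add: D_def funpow_pderiv_add_mult_eq_0_iff del: funpow.simps)
  qed
  then have "poly (Q x) z = 0" for z using divided[of z] by simp
  then have "Q x = 0" using poly_all_0_iff_0 by blast
  then show ?case using rest insert.prems(3) by blast
qed simp

text \<open>If the signs differ, the leading coefficients do not cancel; if they agree, a constant
  difference would make \<open>pderiv P\<close> a periodic polynomial, hence constant.\<close>

lemma degree_signed_shift_diff:
  fixes P :: "complex poly" and h k s t :: complex
  assumes "degree P \<ge> 2" and s: "s = 1 \<or> s = -1" and t: "t = 1 \<or> t = -1"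
    and "h \<noteq> k \<or> s \<noteq> t"
  shows "degree (smult s (P \<circ>\<^sub>p [:h, 1:]) - smult t (P \<circ>\<^sub>p [:k, 1:])) \<noteq> 0"
proof
  assume deg: "degree (smult s (P \<circ>\<^sub>p [:h, 1:]) - smult t (P \<circ>\<^sub>p [:k, 1:])) = 0"
  have lead: "coeff (P \<circ>\<^sub>p [:u, 1:]) (degree P) = lead_coeff P" for u
    using lead_coeff_comp[of "[:u, 1:]" P] by (simp add: degree_pcompose)
  have "coeff (smult s (P \<circ>\<^sub>p [:h, 1:]) - smult t (P \<circ>\<^sub>p [:k, 1:])) (degree P) = 0"
    using deg assms(1) by (intro coeff_eq_0) linarith
  then have "(s - t) * lead_coeff P = 0"
    using lead by (simp add: algebra_simps)
  then have "s = t" using assms(1) by auto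
  then have "h \<noteq> k" using assms(4) by simp
  have "s \<noteq> 0" using s by auto
  have "pderiv (smult s (P \<circ>\<^sub>p [:h, 1:]) - smult t (P \<circ>\<^sub>p [:k, 1:])) = 0"
    using deg by (simp add: pderiv_eq_0_iff)
  then have "smult s (pderiv P \<circ>\<^sub>p [:h, 1:] - pderiv P \<circ>\<^sub>p [:k, 1:]) = 0"
    by (simp add: \<open>s = t\<close> pderiv_diff pderiv_smult pderiv_pcompose pderiv_pCons smult_diff_right)
  then have eq: "pderiv P \<circ>\<^sub>p [:h, 1:] = pderiv P \<circ>\<^sub>p [:k, 1:]"
    using \<open>s \<noteq> 0\<close> by simp
  have "poly (pderiv P) (z + (h - k)) = poly (pderiv P) z" for z
    using arg_cong[OF eq, of "\<lambda>q. poly q (z - k)"] by (simp add: poly_pcompose algebra_simps)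
  then have "degree (pderiv P) = 0"
    using degree_zero_if_periodic[of "h - k" "pderiv P"] \<open>h \<noteq> k\<close> by simp
  then show False using assms(1) by (simp add: degree_pderiv)
qed

section \<open>Entire functions whose real part has polynomial mean growth\<close>

lemma circle_integral_fourier_coeff:
  fixes g :: "complex \<Rightarrow> complex"
  assumes hol: "g holomorphic_on UNIV" and "r > 0"
  shows "((\<lambda>t. g (of_real r * cis t) * cis (- (real n * t))) has_integral
           2 * pi / fact n * (deriv ^^ n) g 0 * of_real r ^ n) {0..2*pi}"
proof -
  have "((\<lambda>u. g u / (u - 0) ^ Suc n) has_contour_integral
        (2 * pi * \<i> / fact n * (deriv ^^ n) g 0)) (circlepath 0 r)"
    using assms
    by (intro Cauchy_has_contour_integral_higher_derivative_circlepath)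
       (auto intro: holomorphic_on_imp_continuous_on holomorphic_on_subset)
  then have "((\<lambda>t. g (of_real r * cis t) / (of_real r * cis t) ^ Suc n * of_real r * \<i> * cis t)
      has_integral (2 * pi * \<i> / fact n * (deriv ^^ n) g 0)) {0..2*pi}"
    unfolding circlepath_def by (subst (asm) has_contour_integral_part_circlepath_iff) simp_all
  then have "((\<lambda>t. of_real r ^ n / \<i> *
        (g (of_real r * cis t) / (of_real r * cis t) ^ Suc n * of_real r * \<i> * cis t))
      has_integral of_real r ^ n / \<i> * (2 * pi * \<i> / fact n * (deriv ^^ n) g 0)) {0..2*pi}"
    by (rule has_integral_mult_right)
  moreover have "of_real r ^ n / \<i> *
        (g (of_real r * cis t) / (of_real r * cis t) ^ Suc n * of_real r * \<i> * cis t)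
      = g (of_real r * cis t) * cis (- (real n * t))" for t
  proof -
    have "cis (- (real n * t)) = 1 / cis t ^ n"
      by (simp add: Complex.DeMoivre cis_inverse[symmetric] inverse_eq_divide del: cis_inverse)
    then show ?thesis
      using \<open>r > 0\<close> cis_neq_zero[of t] by (simp add: power_mult_distrib field_simps)
  qed
  ultimately show ?thesis by (simp add: mult_ac)
qed

lemma circle_integral_mult_cis_eq_0:
  fixes g :: "complex \<Rightarrow> complex"
  assumes hol: "g holomorphic_on UNIV" and "r > 0" and "n > 0"
  shows "((\<lambda>t. g (of_real r * cis t) * cis (real n * t)) has_integral 0) {0..2*pi}"
proof -
  have "((\<lambda>u. g u * u ^ (n - 1)) has_contour_integral 0) (circlepath 0 r)"
    using hol by (intro Cauchy_theorem_convex_simple[of _ UNIV] holomorphic_intros) auto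
  then have "((\<lambda>t. g (of_real r * cis t) * (of_real r * cis t) ^ (n - 1) * of_real r * \<i> * cis t)
      has_integral 0) {0..2*pi}"
    unfolding circlepath_def by (subst (asm) has_contour_integral_part_circlepath_iff) simp_all
  then have "((\<lambda>t. inverse (of_real r ^ n * \<i>) *
        (g (of_real r * cis t) * (of_real r * cis t) ^ (n - 1) * of_real r * \<i> * cis t))
      has_integral inverse (of_real r ^ n * \<i>) * 0) {0..2*pi}"
    by (rule has_integral_mult_right)
  moreover have "inverse (of_real r ^ n * \<i>) *
        (g (of_real r * cis t) * (of_real r * cis t) ^ (n - 1) * of_real r * \<i> * cis t)
      = g (of_real r * cis t) * cis (real n * t)" for t
  proof -
    have "(of_real r * cis t) ^ (n - 1) * of_real r * cis t = (of_real r * cis t) ^ n"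
      using \<open>n > 0\<close> by (cases n) (auto simp: algebra_simps)
    then have "g (of_real r * cis t) * (of_real r * cis t) ^ (n - 1) * of_real r * \<i> * cis t
      = g (of_real r * cis t) * \<i> * (of_real r ^ n * cis (real n * t))"
      by (simp add: power_mult_distrib Complex.DeMoivre algebra_simps)
    then show ?thesis using \<open>r > 0\<close> by (simp add: field_simps)
  qed
  ultimately show ?thesis by simp
qed

text \<open>For \<open>n > 0\<close>, the \<open>n\<close>-th Fourier coefficient of \<open>cnj g\<close> on a circle about 0 vanishes, so
  that of \<open>2 * Re g = g + cnj g\<close> is the one of \<open>g\<close>.\<close>

lemma norm_higher_deriv_le_integral_Re:
  fixes g :: "complex \<Rightarrow> complex"
  assumes hol: "g holomorphic_on UNIV" and "r > 0" and "n > 0"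
  shows "pi / fact n * norm ((deriv ^^ n) g 0) * r ^ n
           \<le> integral {0..2*pi} (\<lambda>t. \<bar>Re (g (of_real r * cis t))\<bar>)"
proof -
  let ?u = "\<lambda>t. Re (g (of_real r * cis t))"
  let ?I = "2 * pi / fact n * (deriv ^^ n) g 0 * of_real r ^ n"
  have "((\<lambda>t. cnj (g (of_real r * cis t) * cis (real n * t))) has_integral cnj 0) {0..2*pi}"
    using has_integral_linear[OF circle_integral_mult_cis_eq_0[OF assms] bounded_linear_cnj]
    by (simp add: o_def)
  then have cnj: "((\<lambda>t. cnj (g (of_real r * cis t)) * cis (- (real n * t))) has_integral 0) {0..2*pi}"
    by (simp add: cis_cnj)
  have "((\<lambda>t. g (of_real r * cis t) * cis (- (real n * t))
      + cnj (g (of_real r * cis t)) * cis (- (real n * t))) has_integral ?I + 0) {0..2*pi}"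
    by (rule has_integral_add[OF circle_integral_fourier_coeff[OF hol \<open>r > 0\<close>] cnj])
  moreover have "g (of_real r * cis t) * cis (- (real n * t))
      + cnj (g (of_real r * cis t)) * cis (- (real n * t))
      = complex_of_real (2 * ?u t) * cis (- (real n * t))" for t
    by (metis complex_add_cnj distrib_right)
  ultimately have int: "((\<lambda>t. complex_of_real (2 * ?u t) * cis (- (real n * t)))
      has_integral ?I) {0..2*pi}"
    by simp
  have cont: "continuous_on A (\<lambda>t. g (of_real r * cis t))" for A
    by (rule continuous_on_compose2[OF holomorphic_on_imp_continuous_on[OF hol]])
       (auto intro!: continuous_intros)
  have "norm ?I \<le> integral {0..2*pi} (\<lambda>t. 2 * \<bar>?u t\<bar>)"
    unfolding integral_unique[OF int, symmetric]
    using int cont by (intro integral_norm_bound_integral)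
      (auto simp: norm_mult intro!: integrable_continuous_real continuous_intros)
  also have "\<dots> = 2 * integral {0..2*pi} (\<lambda>t. \<bar>?u t\<bar>)" by simp
  finally show ?thesis using \<open>r > 0\<close> by (simp add: norm_mult norm_divide norm_power)
qed

theorem polynomial_if_mean_Re_growth:
  fixes g :: "complex \<Rightarrow> complex"
  assumes hol: "g holomorphic_on UNIV"
    and growth: "eventually (\<lambda>r. integral {0..2*pi} (\<lambda>t. \<bar>Re (g (of_real r * cis t))\<bar>) \<le> B * r ^ N) at_top"
  shows "\<exists>P. \<forall>z. g z = poly P z"
proof -
  have zero: "(deriv ^^ n) g 0 = 0" if "n > N" for n
  proof -
    let ?C = "pi / fact n * norm ((deriv ^^ n) g 0)"
    have bound: "eventually (\<lambda>r. ?C * r \<le> B) at_top"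
      using growth eventually_ge_at_top[of 1]
    proof eventually_elim
      case (elim r)
      then have "?C * r ^ n \<le> B * r ^ N"
        using norm_higher_deriv_le_integral_Re[OF hol, of r n] that by linarith
      moreover have "?C * r ^ Suc N \<le> ?C * r ^ n"
        using elim that by (intro mult_left_mono power_increasing) auto
      ultimately have "(?C * r) * r ^ N \<le> B * r ^ N" by (simp add: mult_ac)
      moreover have "r ^ N > 0" using elim by simp
      ultimately show ?case using mult_le_cancel_right_pos by blast
    qed
    have "\<not> ?C > 0"
    proof
      assume "?C > 0"
      then have "filterlim (\<lambda>r. ?C * r) at_top at_top"
        using filterlim_tendsto_pos_mult_at_top[OF tendsto_const _ filterlim_ident] by blast
      then have "eventually (\<lambda>r. ?C * r > B) at_top"
        by (simp add: filterlim_at_top_dense)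
      with bound have "eventually (\<lambda>r::real. False) at_top"
        by eventually_elim linarith
      then show False by simp
    qed
    then show ?thesis by (auto simp: zero_less_divide_iff zero_less_mult_iff)
  qed
  define P where "P = (\<Sum>n\<le>N. monom ((deriv ^^ n) g 0 / fact n) n)"
  have "g z = poly P z" for z
  proof -
    have "((\<lambda>n. (deriv ^^ n) g 0 / fact n * (z - 0) ^ n) sums g z)"
      using hol by (intro holomorphic_power_series[of g 0 "norm z + 1"])
        (auto intro: holomorphic_on_subset)
    moreover have "(\<lambda>n. (deriv ^^ n) g 0 / fact n * (z - 0) ^ n) sums
        (\<Sum>n\<le>N. (deriv ^^ n) g 0 / fact n * (z - 0) ^ n)"
      by (rule sums_finite) (auto simp: zero)
    ultimately show ?thesis
      by (simp add: P_def poly_sum poly_monom sums_unique2)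
  qed
  then show ?thesis by blast
qed

section \<open>The characteristic of an entire function of finite order\<close>

lemma nevanlinna_T_entire:
  assumes "f holomorphic_on UNIV"
  shows "nevanlinna_T r f = proximity_fun r f"
proof -
  have "\<not> is_pole f z" for z
    using assms not_is_pole_holomorphic[of UNIV z f] by simp
  then have "pole_count t f = 0" for t by (simp add: pole_count_def)
  then show ?thesis by (simp add: nevanlinna_T_def counting_fun_def)
qed

lemma finite_order_imp_power_bound:
  assumes "finite_order f"
  obtains N :: nat where "eventually (\<lambda>r. nevanlinna_T r f \<le> r ^ N) at_top"
proof -
  have "growth_order f < \<infinity>" using assms by (simp add: finite_order_def)
  then obtain K :: real where K: "growth_order f < ereal K"
    using less_ereal.simps(4) ereal_dense2 by blast
  obtain N :: nat where N: "K < real N" using reals_Archimedean2 by blast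
  have "eventually (\<lambda>r::real. ereal (ln (nevanlinna_T r f) / ln r) < ereal K) at_top"
    using K unfolding growth_order_def by (rule Limsup_lessD)
  then have "eventually (\<lambda>r. nevanlinna_T r f \<le> r ^ N) at_top"
    using eventually_gt_at_top[of 1]
  proof eventually_elim
    case (elim r)
    show ?case
    proof (cases "nevanlinna_T r f > 0")
      case True
      have "ln (nevanlinna_T r f) / ln r < real N" using elim N by simp
      then have "ln (nevanlinna_T r f) < real N * ln r"
        using elim by (simp add: pos_divide_less_eq)
      then have "ln (nevanlinna_T r f) < ln (r ^ N)" using elim by (simp add: ln_realpow)
      then show ?thesis using True elim by simp
    next
      case False
      moreover have "0 \<le> r ^ N" using elim by simp
      ultimately show ?thesis by linarith
    qed
  qed
  then show ?thesis using that by blast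
qed

lemma log_plus_eq_ln_max: "log_plus x = ln (max 1 x)"
  by (simp add: log_plus_def max_def)

lemma abs_Re_le_log_plus_cosh:
  "\<bar>Re w\<bar> \<le> log_plus (norm ((exp w + exp (- w)) / 2)) + ln 3"
proof -
  let ?m = "norm ((exp w + exp (- w)) / 2)"
  have "exp \<bar>Re w\<bar> - 1 \<le> \<bar>exp (Re w) - exp (- Re w)\<bar>"
    by (cases "Re w \<ge> 0") (auto simp: abs_if)
  \<comment> \<open>reverse triangle inequality\<close>
  also have "\<dots> \<le> norm (exp w + exp (- w))"
    using norm_triangle_ineq3[of "exp w" "- exp (- w)"] by simp
  also have "\<dots> = 2 * ?m" by (simp add: norm_divide)
  finally have "exp \<bar>Re w\<bar> \<le> 3 * max 1 ?m" by (simp add: max_def)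
  then have "\<bar>Re w\<bar> \<le> ln (3 * max 1 ?m)"
    by (subst ln_ge_iff) (auto simp: max_def)
  also have "\<dots> = ln (max 1 ?m) + ln 3" by (subst ln_mult) (auto simp: max_def)
  finally show ?thesis by (simp add: log_plus_eq_ln_max)
qed

lemma integral_abs_Re_le_nevanlinna_T_cosh:
  fixes g :: "complex \<Rightarrow> complex"
  assumes hol: "g holomorphic_on UNIV"
    and f: "\<And>z. f z = (exp (g z) + exp (- g z)) / 2"
  shows "integral {0..2*pi} (\<lambda>t. \<bar>Re (g (of_real r * cis t))\<bar>) \<le> 2 * pi * (nevanlinna_T r f + ln 3)"
proof -
  let ?l = "\<lambda>t. log_plus (norm (f (of_real r * cis t)))"
  have f': "f = (\<lambda>z. (exp (g z) + exp (- g z)) / 2)" using f by blast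
  have holf: "f holomorphic_on UNIV"
    unfolding f' using hol by (intro holomorphic_intros) auto
  have cont: "continuous_on A (\<lambda>t. h (of_real r * cis t))" if "h holomorphic_on UNIV" for A h
    by (rule continuous_on_compose2[OF holomorphic_on_imp_continuous_on[OF that]])
       (auto intro!: continuous_intros)
  have intl: "?l integrable_on {0..2*pi}"
    unfolding log_plus_eq_ln_max
    by (intro integrable_continuous_real continuous_intros cont holf) (auto simp: max_def)
  have "integral {0..2*pi} (\<lambda>t. \<bar>Re (g (of_real r * cis t))\<bar>)
      \<le> integral {0..2*pi} (\<lambda>t. ?l t + ln 3)"
  proof (intro integral_le integrable_add intl)
    show "\<bar>Re (g (of_real r * cis t))\<bar> \<le> ?l t + ln 3" for t
      using abs_Re_le_log_plus_cosh[of "g (of_real r * cis t)"] by (simp only: f)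
  qed (auto intro!: integrable_continuous_real continuous_intros cont hol)
  also have "\<dots> = integral {0..2*pi} ?l + 2 * pi * ln 3"
    using intl by (subst integral_add) auto
  also have "integral {0..2*pi} ?l = 2 * pi * nevanlinna_T r f"
    by (simp add: nevanlinna_T_entire[OF holf] proximity_fun_def cis_conv_exp)
  finally show ?thesis by (simp add: algebra_simps)
qed

theorem cosh_finite_order_imp_polynomial:
  fixes g :: "complex \<Rightarrow> complex"
  assumes hol: "g holomorphic_on UNIV"
    and f: "\<And>z. f z = (exp (g z) + exp (- g z)) / 2"
    and "finite_order f"
  shows "\<exists>P. \<forall>z. g z = poly P z"
proof -
  obtain N where N: "eventually (\<lambda>r. nevanlinna_T r f \<le> r ^ N) at_top"
    using finite_order_imp_power_bound[OF assms(3)] .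
  have "eventually (\<lambda>r. integral {0..2*pi} (\<lambda>t. \<bar>Re (g (of_real r * cis t))\<bar>)
      \<le> (2 * pi * (1 + ln 3)) * r ^ N) at_top"
    using N eventually_ge_at_top[of 1]
  proof eventually_elim
    case (elim r)
    have "(ln 3 :: real) * 1 \<le> ln 3 * r ^ N"
      using elim by (intro mult_left_mono) auto
    then have "nevanlinna_T r f + ln 3 \<le> r ^ N + ln 3 * r ^ N"
      using elim by linarith
    also have "\<dots> = (1 + ln 3) * r ^ N" by (simp add: distrib_right)
    finally have "nevanlinna_T r f + ln 3 \<le> (1 + ln 3) * r ^ N" .
    then have "2 * pi * (nevanlinna_T r f + ln 3) \<le> 2 * pi * ((1 + ln 3) * r ^ N)"
      by (intro mult_left_mono) auto
    with integral_abs_Re_le_nevanlinna_T_cosh[OF hol f, of r] show ?case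
      unfolding mult.assoc by (rule order_trans)
  qed
  then show ?thesis using polynomial_if_mean_Re_growth[OF hol] by blast
qed

section \<open>The equation\<close>

lemma entire_sum_squares_eq_1:
  fixes f L :: "complex \<Rightarrow> complex"
  assumes "f holomorphic_on UNIV" "L holomorphic_on UNIV"
    and eq: "\<And>z. (f z)\<^sup>2 + (L z)\<^sup>2 = 1"
  obtains g where "g holomorphic_on UNIV"
    and "\<And>z. f z = (exp (g z) + exp (- g z)) / 2"
    and "\<And>z. L z = (exp (g z) - exp (- g z)) / (2 * \<i>)"
proof -
  have prod: "(f z + \<i> * L z) * (f z - \<i> * L z) = 1" for z
    using eq[of z] by (simp add: algebra_simps power2_eq_square)
  have hol: "(\<lambda>z. f z + \<i> * L z) holomorphic_on UNIV"
    using assms by (intro holomorphic_intros)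
  obtain g where g: "g holomorphic_on UNIV" "\<And>z. f z + \<i> * L z = exp (g z)"
    using contractible_imp_holomorphic_log[OF hol] prod
    by (metis UNIV_I contractible_UNIV mult_zero_left zero_neq_one)
  have minus: "f z - \<i> * L z = exp (- g z)" for z
    using prod[of z] by (simp add: g(2) exp_minus field_simps)
  show ?thesis
  proof
    show "f z = (exp (g z) + exp (- g z)) / 2" for z
      by (simp add: g(2)[symmetric] minus[symmetric])
    show "L z = (exp (g z) - exp (- g z)) / (2 * \<i>)" for z
      by (simp add: g(2)[symmetric] minus[symmetric])
  qed (fact g(1))
qed

text \<open>The hypothesis is the equation \<open>L = - \<i> sinh P\<close> for \<open>f = cosh P\<close>, multiplied by 2.\<close>

lemma cosh_shift_equation_degree_less_2:
  fixes P :: "complex poly" and a :: "nat \<Rightarrow> complex"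
  assumes "\<tau> \<ge> 1" "c \<noteq> 0" "a \<tau> \<noteq> 0"
    and eq: "\<And>z. (\<Sum>j=0..\<tau>. a j * (exp (poly P (z + of_nat j * c)) + exp (- poly P (z + of_nat j * c))))
                 = - \<i> * (exp (poly P z) - exp (- poly P z))"
  shows "degree P < 2"
proof (rule ccontr)
  assume "\<not> degree P < 2"
  then have deg: "degree P \<ge> 2" by simp
  \<comment> \<open>The terms are indexed by a sign \<open>s\<close> and a shift \<open>j\<close>; the right-hand side of \<open>eq\<close>
    contributes to the coefficients with \<open>j = 0\<close> only.\<close>
  define R where "R = (\<lambda>(s::complex, j::nat). smult s (P \<circ>\<^sub>p [:of_nat j * c, 1:]))"
  define Q where "Q = (\<lambda>(s::complex, j::nat). [:a j + (if j = 0 then s * \<i> else 0):])"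
  let ?F = "{1, -1} \<times> {0..\<tau>}"
  have "(\<Sum>i\<in>?F. poly (Q i) z * exp (poly (R i) z)) = 0" for z
  proof -
    let ?e = "\<lambda>s j. exp (s * poly P (z + of_nat j * c))"
    have "(\<Sum>i\<in>?F. poly (Q i) z * exp (poly (R i) z))
        = (\<Sum>s\<in>{1,-1}. \<Sum>j=0..\<tau>. poly (Q (s, j)) z * exp (poly (R (s, j)) z))"
      by (simp add: sum.cartesian_product)
    also have "\<dots> = (\<Sum>s\<in>{1,-1}. \<Sum>j=0..\<tau>. a j * ?e s j + (if j = 0 then s * \<i> * ?e s 0 else 0))"
      by (intro sum.cong refl) (auto simp: Q_def R_def poly_pcompose algebra_simps)
    also have "\<dots> = (\<Sum>s\<in>{1,-1}. (\<Sum>j=0..\<tau>. a j * ?e s j) + s * \<i> * ?e s 0)"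
      by (simp add: sum.distrib)
    also have "\<dots> = (\<Sum>j=0..\<tau>. a j * (?e 1 j + ?e (-1) j)) + \<i> * (?e 1 0 - ?e (-1) 0)"
      by (simp add: sum.distrib algebra_simps)
    also have "\<dots> = 0" using eq[of z] by simp
    finally show ?thesis .
  qed
  moreover have "degree (R i - R j) \<noteq> 0" if "i \<in> ?F" "j \<in> ?F" "i \<noteq> j" for i j
  proof -
    obtain s k t l where ij: "i = (s, k)" "j = (t, l)" by (cases i; cases j)
    have "of_nat k * c \<noteq> of_nat l * c \<or> s \<noteq> t" using that ij \<open>c \<noteq> 0\<close> by auto
    then show ?thesis
      using degree_signed_shift_diff[OF deg, of s t "of_nat k * c" "of_nat l * c"] that ij
      by (auto simp: R_def)
  qed
  ultimately have "Q (1, \<tau>) = 0"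
    by (intro exp_poly_linear_independent[of ?F R Q]) auto
  then show False using assms(1,3) by (simp add: Q_def)
qed

theorem theorem2p3:
  fixes \<tau> :: nat and c :: complex and a :: "nat \<Rightarrow> complex" and f :: "complex \<Rightarrow> complex"
  assumes "\<tau> \<ge> 1"
    and "c \<noteq> 0"
    and "a \<tau> \<noteq> 0"
    and "transcendental_entire f"
    and "finite_order f"
    and "\<forall>z. (f z)\<^sup>2 + (shift_op \<tau> a c z f)\<^sup>2 = 1"
  shows "(\<exists>\<alpha> \<beta> :: complex.
            (\<forall>z. f z = (exp (\<alpha> * z + \<beta>) + exp (- (\<alpha> * z + \<beta>))) / 2) \<and>
            (\<Sum>j=0..\<tau>. a j * exp (of_nat j * \<alpha> * c)) = - \<i> \<and>
            (\<Sum>j=0..\<tau>. a j * exp (- (of_nat j * \<alpha> * c))) = \<i> \<and>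
            exp (\<alpha> * c) \<noteq> 1 \<and> exp (\<alpha> * c) \<noteq> - 1) \<and>
         (\<tau> = 1 \<longrightarrow> a 0 \<noteq> a 1 \<and> a 0 \<noteq> - a 1)"
proof -
  have holf: "f holomorphic_on UNIV" and nonpoly: "\<And>p. \<exists>z. f z \<noteq> poly p z"
    using assms(4) by (auto simp: transcendental_entire_def)
  have shift: "(\<lambda>z. f (z + w)) holomorphic_on UNIV" for w
    using holomorphic_on_compose_gen[OF _ holf, of "\<lambda>z. z + w" UNIV]
    by (simp add: o_def holomorphic_intros)
  have holL: "(\<lambda>z. shift_op \<tau> a c z f) holomorphic_on UNIV"
    unfolding shift_op_def by (intro holomorphic_intros shift)
  obtain g where g: "g holomorphic_on UNIV"
    and fg: "\<And>z. f z = (exp (g z) + exp (- g z)) / 2"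
    and Lg: "\<And>z. shift_op \<tau> a c z f = (exp (g z) - exp (- g z)) / (2 * \<i>)"
    using entire_sum_squares_eq_1[OF holf holL] assms(6) by blast
  obtain P where P: "\<And>z. g z = poly P z"
    using cosh_finite_order_imp_polynomial[OF g fg assms(5)] by blast
  have eq: "(\<Sum>j=0..\<tau>. a j * (exp (poly P (z + of_nat j * c)) + exp (- poly P (z + of_nat j * c))))
      = - \<i> * (exp (poly P z) - exp (- poly P z))" for z
  proof -
    have "(\<Sum>j=0..\<tau>. a j * (exp (poly P (z + of_nat j * c)) + exp (- poly P (z + of_nat j * c))))
        = 2 * shift_op \<tau> a c z f"
      by (simp add: shift_op_def fg P sum_distrib_left)
    also have "\<dots> = - \<i> * (exp (poly P z) - exp (- poly P z))"
      by (simp add: Lg P field_simps)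
    finally show ?thesis .
  qed
  have "degree P < 2"
    using cosh_shift_equation_degree_less_2[OF assms(1-3) eq] .
  moreover have "degree P \<noteq> 0"
  proof
    assume "degree P = 0"
    then obtain b where "P = [:b:]" by (rule degree_eq_zeroE)
    then have "f z = poly [:(exp b + exp (- b)) / 2:] z" for z by (simp add: fg P)
    then show False using nonpoly by blast
  qed
  ultimately have "degree P = 1" by linarith
  then obtain \<alpha> \<beta> where P_eq: "P = [:\<beta>, \<alpha>:]" and "\<alpha> \<noteq> 0"
    using degree1_coeffs[of P] by blast
  define A where "A = (\<Sum>j=0..\<tau>. a j * exp (of_nat j * \<alpha> * c))"
  define B where "B = (\<Sum>j=0..\<tau>. a j * exp (- (of_nat j * \<alpha> * c)))"
  \<comment> \<open>As \<open>z\<close> varies, \<open>x = exp (\<alpha> * z + \<beta>)\<close> takes every nonzero value.\<close>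
  have lin: "A * x + B / x = - \<i> * (x - 1 / x)" if "x \<noteq> 0" for x
  proof -
    define z where "z = (Ln x - \<beta>) / \<alpha>"
    have "\<alpha> * z + \<beta> = Ln x" using \<open>\<alpha> \<noteq> 0\<close> by (simp add: z_def)
    then have "poly P (z + of_nat j * c) = Ln x + of_nat j * \<alpha> * c" for j
      by (simp add: P_eq algebra_simps)
    then have e: "exp (poly P (z + of_nat j * c)) = exp (of_nat j * \<alpha> * c) * x"
      "exp (- poly P (z + of_nat j * c)) = exp (- (of_nat j * \<alpha> * c)) / x" for j
      using that by (simp_all add: exp_add exp_diff exp_minus field_simps)
    have e0: "exp (poly P z) = x" "exp (- poly P z) = 1 / x"
      using e(1)[of 0] e(2)[of 0] by simp_all
    have "A * x + B / x
        = (\<Sum>j=0..\<tau>. a j * (exp (of_nat j * \<alpha> * c) * x + exp (- (of_nat j * \<alpha> * c)) / x))"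
      by (simp add: A_def B_def sum_distrib_right sum_divide_distrib sum.distrib ring_distribs mult.assoc)
    also have "\<dots> = - \<i> * (x - 1 / x)"
      using eq[of z] unfolding e e0 .
    finally show ?thesis .
  qed
  have "A + B = 0" using lin[of 1] by simp
  moreover have "\<i> * (A - B) = 2"
    using lin[of \<i>] by (simp add: algebra_simps)
  ultimately have "B = - A" "2 * \<i> * A = 2" by (auto simp: algebra_simps add_eq_0_iff)
  then have A: "A = - \<i>" and B: "B = \<i>"
    by (auto simp: complex_eq_iff)
  define w where "w = exp (\<alpha> * c)"
  have exps: "exp (of_nat j * \<alpha> * c) = w ^ j" "exp (- (of_nat j * \<alpha> * c)) = inverse w ^ j" for j
    by (simp_all add: w_def exp_of_nat_mult[symmetric] exp_minus power_inverse mult.assoc)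
  have "inverse w \<noteq> w"
  proof
    assume "inverse w = w"
    then have "A = B" by (simp add: A_def B_def exps)
    then show False unfolding A B by (simp add: complex_eq_iff)
  qed
  then have w: "w \<noteq> 1" "w \<noteq> - 1" by auto
  have "a 0 \<noteq> a 1 \<and> a 0 \<noteq> - a 1" if "\<tau> = 1"
  proof -
    have "w \<noteq> 0" by (simp add: w_def)
    have 1: "a 0 + a 1 * w = - \<i>" using A that by (simp add: A_def exps)
    have "a 0 + a 1 * inverse w = \<i>" using B that by (simp add: B_def exps)
    then have 2: "a 0 * w + a 1 = \<i> * w" using \<open>w \<noteq> 0\<close> by (simp add: field_simps)
    show ?thesis
    proof (intro conjI notI)
      assume "a 0 = a 1"
      then have "\<i> * w = \<i> * (- 1)" using 1 2 by (simp add: algebra_simps)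
      then have "w = - 1" by (subst (asm) mult_cancel_left) auto
      then show False using w by simp
    next
      assume "a 0 = - a 1"
      then have "\<i> + a 1 * w = \<i> * w + a 1 * w" using 1 2 by (simp add: algebra_simps)
      then have "\<i> * w = \<i>" by simp
      then show False using w by simp
    qed
  qed
  moreover have "f z = (exp (\<alpha> * z + \<beta>) + exp (- (\<alpha> * z + \<beta>))) / 2" for z
    by (simp add: fg P P_eq algebra_simps)
  ultimately show ?thesis
    using A B w unfolding A_def B_def w_def by blast
qed

end
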